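(* Let $(A,\mu,\Delta,\alpha)$ be an $\epsilon$-Hom-bialgebra and $r\in A^{\otimes 2}$ be an $\alpha$-invariant $2$-tensor. Define the perturbed comultiplication $\Delta'=\Delta+\Delta_r\colon A\to A^{\otimes 2}$, where $\Delta_r=[-,r]_*$. Then $A'=(A,\mu,\Delta',\alpha)$ is an $\epsilon$-Hom-bialgebra if and only if $$[a,(\alpha\otimes\Delta)^-(r)-A(r)]_\bullet=r_{23}\Delta(a)_{13}+\Delta(a)_{13}r_{12}$$ for all $a\in A$.
   Context: Throughout, $\mathbf{k}$ is a fixed field of characteristic $0$; vector spaces, linear maps and tensor products are over $\mathbf{k}$. An $\epsilon$-Hom-bialgebra $(A,\mu,\Delta,\alpha)$ is a $\mathbf{k}$-vector space $A$ with linear maps $\mu\colon A^{\otimes 2}\to A$, $\Delta\colon A\to A^{\otimes 2}$, $\alpha\colon A\to A$ such that: $\alpha\circ\mu=\mu\circ\alpha^{\otimes 2}$; $\mu\circ(\alpha\otimes\mu)=\mu\circ(\mu\otimes\alpha)$; $\alpha^{\otimes 2}\circ\Delta=\Delta\circ\alpha$; $(\alpha\otimes\Delta)\circ\Delta=(\Delta\otimes\alpha)\circ\Delta$; and $\Delta\circ\mu=(\mu\otimes\alpha)\circ(\alpha\otimes\Delta)+(\alpha\otimes\mu)\circ(\Delta\otimes\alpha)$. An element of $A^{\otimes 2}$ is $\alpha$-invariant if it is fixed by $\alpha^{\otimes 2}$. For $a\in A$ and $r=\sum u_i\otimes v_i\in A^{\otimes 2}$, set $[a,r]_*=\sum\mu(a,u_i)\otimes\alpha(v_i)-\alpha(u_i)\otimes\mu(v_i,a)$.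 The map $(\alpha\otimes\Delta)^-\colon A^{\otimes 2}\to A^{\otimes 3}$ is $(\alpha\otimes\Delta)^-=\alpha\otimes\Delta-\Delta\otimes\alpha$. For $r=\sum u_i\otimes v_i$ and $s=\sum u_j'\otimes v_j'$ in $A^{\otimes 2}$, define the $3$-tensors $$r_{13}s_{12}=\sum\mu(u_i,u_j')\otimes\alpha(v_j')\otimes\alpha(v_i),\qquad r_{12}s_{23}=\sum\alpha(u_i)\otimes\mu(v_i,u_j')\otimes\alpha(v_j'),$$ $$r_{23}s_{13}=\sum\alpha(u_j')\otimes\alpha(u_i)\otimes\mu(v_i,v_j'),\qquad A(r)=r_{13}r_{12}-r_{12}r_{23}+r_{23}r_{13}.$$ In particular, writing $\Delta(a)=\sum a_1\otimes a_2$, one has $r_{23}\Delta(a)_{13}=\sum\alpha(a_1)\otimes\alpha(u_i)\otimes\mu(v_i,a_2)$ and $\Delta(a)_{13}r_{12}=\sum\mu(a_1,u_i)\otimes\alpha(v_i)\otimes\alpha(a_2)$. For $a\in A$ and $b=\sum b_1\otimes\cdots\otimes b_n\in A^{\otimes n}$, set $$[a,b]_\bullet=\sum\mu(\alpha(a),b_1)\otimes\alpha(b_2)\otimes\cdots\otimes\alpha(b_n)-\alpha(b_1)\otimes\cdots\otimes\alpha(b_{n-1})\otimes\mu(b_n,\alpha(a)).$$ *)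

theory Defs
  imports Complex_Main "HOL-Library.Function_Algebras"
begin

section \<open>Tensor powers of a vector space\<close>

text \<open>
  The vector space $A$ is a whole type with scalar multiplication \<open>s\<close>.  All tensor powers of $A$
  live in one type: a pure tensor is a word \<open>xs\<close> over $A$, acting by evaluation on multilinear
  forms, and $A^{\otimes n}$ is the span of the words of length \<open>n\<close>.  A form \<open>\<phi>\<close> on words is a
  family of forms, one for each length; \<open>multilinear\<close> asks for linearity in each letter of
  words of every length.  That this is a tensor power is the universal property
  \<open>tensor_power_universal\<close> and \<open>tensor_power_unique\<close> below.
\<close>

type_synonym ('k, 'a) tensor = "('a list \<Rightarrow> 'k) \<Rightarrow> 'k"

definition multilinear ::
  "('k::field \<Rightarrow> 'a::ab_group_add \<Rightarrow> 'a) \<Rightarrow> ('k \<Rightarrow> 'w::ab_group_add \<Rightarrow> 'w) \<Rightarrow> ('a list \<Rightarrow> 'w) \<Rightarrow> bool"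
  where "multilinear s s' F \<longleftrightarrow> (\<forall>xs ys. Vector_Spaces.linear s s' (\<lambda>x. F (xs @ x # ys)))"

definition tensor :: "('k::field \<Rightarrow> 'a::ab_group_add \<Rightarrow> 'a) \<Rightarrow> 'a list \<Rightarrow> ('k, 'a) tensor"
  where "tensor s xs = (\<lambda>\<phi>. if multilinear s (*) \<phi> then \<phi> xs else 0)"

definition tscale :: "'k::field \<Rightarrow> ('k, 'a) tensor \<Rightarrow> ('k, 'a) tensor"
  where "tscale c t = (\<lambda>\<phi>. c * t \<phi>)"

definition tensor_power :: "('k::field \<Rightarrow> 'a::ab_group_add \<Rightarrow> 'a) \<Rightarrow> nat \<Rightarrow> ('k, 'a) tensor set"
  where "tensor_power s n = module.span tscale {tensor s xs | xs. length xs = n}"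

text \<open>
  Linear extension of a multilinear map \<open>F\<close> from words to tensors
  (see \<open>tensor_lift_tensor\<close> and \<open>linear_tensor_lift\<close>).
\<close>

definition tensor_lift :: "('a list \<Rightarrow> ('k, 'b) tensor) \<Rightarrow> ('k, 'a) tensor \<Rightarrow> ('k, 'b) tensor"
  where "tensor_lift F t = (\<lambda>\<phi>. t (\<lambda>xs. F xs \<phi>))"

definition tensor_lift2 ::
  "('a \<Rightarrow> 'a \<Rightarrow> ('k::field, 'b) tensor) \<Rightarrow> ('k, 'a) tensor \<Rightarrow> ('k, 'b) tensor"
  where "tensor_lift2 f = tensor_lift (\<lambda>xs. case xs of [x, y] \<Rightarrow> f x y | _ \<Rightarrow> 0)"

definition tensor_lift3 ::
  "('a \<Rightarrow> 'a \<Rightarrow> 'a \<Rightarrow> ('k::field, 'b) tensor) \<Rightarrow> ('k, 'a) tensor \<Rightarrow> ('k, 'b) tensor"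
  where "tensor_lift3 f = tensor_lift (\<lambda>xs. case xs of [x, y, z] \<Rightarrow> f x y z | _ \<Rightarrow> 0)"

text \<open>The canonical map $A^{\otimes m} \times A^{\otimes n} \to A^{\otimes (m+n)}$.\<close>

definition tensor_times ::
  "('k::field \<Rightarrow> 'a::ab_group_add \<Rightarrow> 'a) \<Rightarrow> ('k, 'a) tensor \<Rightarrow> ('k, 'a) tensor \<Rightarrow> ('k, 'a) tensor"
  where "tensor_times s t u = tensor_lift (\<lambda>xs. tensor_lift (\<lambda>ys. tensor s (xs @ ys)) u) t"

lemma vector_space_tscale: "vector_space (tscale :: 'k::field \<Rightarrow> ('k, 'a) tensor \<Rightarrow> _)"
  by unfold_locales (auto simp: tscale_def fun_eq_iff algebra_simps)

lemma vector_space_times: "vector_space ((*) :: 'k::field \<Rightarrow> 'k \<Rightarrow> 'k)"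
  by unfold_locales (auto simp: algebra_simps)

lemma linearI:
  assumes "vector_space s" "vector_space s'"
    and "\<And>x y. f (x + y) = f x + f y" "\<And>c x. f (s c x) = s' c (f x)"
  shows "Vector_Spaces.linear s s' f"
  using assms
  by (simp add: Vector_Spaces.linear_def module_hom_def module_hom_axioms_def
      module_iff_vector_space)

lemma linear_addD: "Vector_Spaces.linear s s' f \<Longrightarrow> f (x + y) = f x + f y"
  by (simp add: Vector_Spaces.linear_def module_hom_def module_hom_axioms_def)

lemma linear_scaleD: "Vector_Spaces.linear s s' f \<Longrightarrow> f (s c x) = s' c (f x)"
  by (simp add: Vector_Spaces.linear_def module_hom_def module_hom_axioms_def)

lemma linear_zeroD: "Vector_Spaces.linear s s' f \<Longrightarrow> f 0 = 0"
  using linear_addD[of s s' f 0 0] by simp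

lemma linear_spacesD:
  "Vector_Spaces.linear s s' f \<Longrightarrow> vector_space s"
  "Vector_Spaces.linear s s' f \<Longrightarrow> vector_space s'"
  by (simp_all add: Vector_Spaces.linear_def)

lemma linear_comp:
  assumes "Vector_Spaces.linear s s' f" "Vector_Spaces.linear s' s'' g"
  shows "Vector_Spaces.linear s s'' (\<lambda>x. g (f x))"
  using assms
  by (intro linearI) (simp_all add: linear_addD linear_scaleD linear_spacesD)

lemma multilinear_tensor:
  assumes "vector_space s"
  shows "multilinear s tscale (tensor s)"
  unfolding multilinear_def
proof (intro allI linearI assms vector_space_tscale)
  fix xs ys x y c
  show "tensor s (xs @ (x + y) # ys) = tensor s (xs @ x # ys) + tensor s (xs @ y # ys)"
    using linear_addD[where s = s and s' = "(*)" and f = "\<lambda>x. \<phi> (xs @ x # ys)" for \<phi>]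
    by (auto simp: tensor_def fun_eq_iff multilinear_def)
  show "tensor s (xs @ s c x # ys) = tscale c (tensor s (xs @ x # ys))"
    using linear_scaleD[where s = s and s' = "(*)" and f = "\<lambda>x. \<phi> (xs @ x # ys)" for \<phi>]
    by (auto simp: tensor_def tscale_def fun_eq_iff multilinear_def)
qed

lemma span_tensor_zero:
  assumes "t \<in> module.span tscale (range (tensor s))" and "\<not> multilinear s (*) \<phi>"
  shows "t \<phi> = 0"
proof -
  interpret T: vector_space "tscale :: 'k::field \<Rightarrow> ('k, 'a) tensor \<Rightarrow> _"
    by (rule vector_space_tscale)
  show ?thesis
    using assms(1)
    by (induction rule: T.span_induct_alt)
      (use assms(2) in \<open>auto simp: tensor_def tscale_def\<close>)
qed

lemma tensor_power_subset:
  "tensor_power s n \<subseteq> module.span tscale (range (tensor s))"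
proof -
  interpret T: vector_space "tscale :: 'k::field \<Rightarrow> ('k, 'a) tensor \<Rightarrow> _"
    by (rule vector_space_tscale)
  show ?thesis
    unfolding tensor_power_def by (rule T.span_mono) auto
qed

lemma tensor_lift_tensor:
  assumes "multilinear s tscale F" and "range F \<subseteq> module.span tscale (range (tensor s'))"
  shows "tensor_lift F (tensor s xs) = F xs"
proof
  fix \<phi>
  have "multilinear s (*) (\<lambda>xs. F xs \<phi>)"
    unfolding multilinear_def
  proof (intro allI linearI vector_space_times)
    fix xs ys x y c
    have L: "Vector_Spaces.linear s tscale (\<lambda>x. F (xs @ x # ys))"
      using assms(1) by (simp add: multilinear_def)
    show "vector_space s"
      using L by (rule linear_spacesD)
    show "F (xs @ (x + y) # ys) \<phi> = F (xs @ x # ys) \<phi> + F (xs @ y # ys) \<phi>"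
      using linear_addD[OF L] by simp
    show "F (xs @ s c x # ys) \<phi> = c * F (xs @ x # ys) \<phi>"
      using linear_scaleD[OF L] by (simp add: tscale_def)
  qed
  then show "tensor_lift F (tensor s xs) \<phi> = F xs \<phi>"
    by (simp add: tensor_lift_def tensor_def)
qed

lemma linear_tensor_lift: "Vector_Spaces.linear tscale tscale (tensor_lift F)"
  by (intro linearI vector_space_tscale) (auto simp: tensor_lift_def tscale_def fun_eq_iff)

lemma tensor_in_span: "tensor s xs \<in> module.span tscale (range (tensor s))"
proof -
  interpret T: vector_space "tscale :: 'k::field \<Rightarrow> ('k, 'a) tensor \<Rightarrow> _"
    by (rule vector_space_tscale)
  show ?thesis
    by (rule T.span_base) simp
qed

lemma tensor_lift2_tensor:
  fixes s :: "'k::field \<Rightarrow> 'a::ab_group_add \<Rightarrow> 'a" and s' :: "'k \<Rightarrow> 'b::ab_group_add \<Rightarrow> 'b"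
  assumes "\<And>y. Vector_Spaces.linear s tscale (\<lambda>x. f x y)"
    and "\<And>x. Vector_Spaces.linear s tscale (\<lambda>y. f x y)"
    and f_in: "\<And>x y. f x y \<in> module.span tscale (range (tensor s'))"
  shows "tensor_lift2 f (tensor s [x, y]) = f x y"
proof -
  interpret T: vector_space "tscale :: 'k \<Rightarrow> ('k, 'b) tensor \<Rightarrow> _"
    by (rule vector_space_tscale)
  let ?F = "\<lambda>xs. case xs of [x, y] \<Rightarrow> f x y | _ \<Rightarrow> 0"
  have zero: "Vector_Spaces.linear s tscale (\<lambda>x. 0 :: ('k, 'b) tensor)"
    using linear_spacesD[OF assms(1)] by (intro linearI) (simp_all add: T.scale_zero_right)
  have "multilinear s tscale ?F"
    unfolding multilinear_def
  proof (intro allI)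
    fix xs ys :: "'a list"
    consider y where "xs = []" "ys = [y]" | x where "xs = [x]" "ys = []"
      | "length xs + length ys \<noteq> 1"
      by (cases xs; cases ys; cases "tl xs"; cases "tl ys") auto
    then show "Vector_Spaces.linear s tscale (\<lambda>x. ?F (xs @ x # ys))"
    proof cases
      case 3
      then have "(\<lambda>x. ?F (xs @ x # ys)) = (\<lambda>x. 0)"
        by (intro ext) (cases xs; cases ys; cases "tl xs"; cases "tl ys"; auto split: list.split)
      then show ?thesis
        using zero by simp
    qed (use assms(1,2) in simp_all)
  qed
  moreover have "range ?F \<subseteq> module.span tscale (range (tensor s'))"
    using f_in T.span_zero by (auto split: list.split)
  ultimately show ?thesis
    by (simp add: tensor_lift2_def tensor_lift_tensor)
qed

lemma tensor_times_tensor: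
  assumes "vector_space s"
  shows "tensor_times s (tensor s xs) (tensor s ys) = tensor s (xs @ ys)"
proof -
  have lin: "Vector_Spaces.linear s tscale (\<lambda>x. tensor s (us @ x # vs))" for us vs
    using multilinear_tensor[OF assms] by (simp add: multilinear_def)
  have inner: "tensor_lift (\<lambda>ys. tensor s (us @ ys)) (tensor s ys) = tensor s (us @ ys)" for us
  proof (rule tensor_lift_tensor[where s' = s])
    show "multilinear s tscale (\<lambda>ys. tensor s (us @ ys))"
      unfolding multilinear_def using lin[of "us @ _"] by simp
  qed (auto intro: tensor_in_span)
  show ?thesis
    unfolding tensor_times_def inner
  proof (rule tensor_lift_tensor[where s' = s])
    show "multilinear s tscale (\<lambda>xs. tensor s (xs @ ys))"
      unfolding multilinear_def using lin by simp
  qed (auto intro: tensor_in_span)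
qed

theorem tensor_power_universal:
  fixes s :: "'k::field \<Rightarrow> 'a::ab_group_add \<Rightarrow> 'a" and s' :: "'k \<Rightarrow> 'w::ab_group_add \<Rightarrow> 'w"
  assumes "vector_space s" "vector_space s'"
    and lin: "\<And>xs ys. length xs + length ys + 1 = n \<Longrightarrow>
      Vector_Spaces.linear s s' (\<lambda>x. F (xs @ x # ys))"
  shows "\<exists>L. Vector_Spaces.linear tscale s' L \<and> (\<forall>xs. length xs = n \<longrightarrow> L (tensor s xs) = F xs)"
proof -
  interpret T: vector_space "tscale :: 'k \<Rightarrow> ('k, 'a) tensor \<Rightarrow> _"
    by (rule vector_space_tscale)
  interpret W: vector_space s' by fact
  interpret TW: vector_space_pair "tscale :: 'k \<Rightarrow> ('k, 'a) tensor \<Rightarrow> _" s' ..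
  interpret K: vector_space "(*) :: 'k \<Rightarrow> _" by (rule vector_space_times)
  interpret WK: vector_space_pair s' "(*) :: 'k \<Rightarrow> _" ..
  interpret TK: vector_space_pair "tscale :: 'k \<Rightarrow> ('k, 'a) tensor \<Rightarrow> _" "(*) :: 'k \<Rightarrow> _" ..
  let ?S = "{tensor s xs | xs. length xs = n}"
  obtain B where B: "B \<subseteq> ?S" "T.independent B" "?S \<subseteq> T.span B"
    using T.maximal_independent_subset by blast
  have "\<forall>b\<in>B. \<exists>xs. length xs = n \<and> b = tensor s xs"
    using B(1) by auto
  then obtain w where w: "\<And>b. b \<in> B \<Longrightarrow> length (w b) = n \<and> b = tensor s (w b)"
    by metis
  obtain L where L: "Vector_Spaces.linear tscale s' L" "\<And>b. b \<in> B \<Longrightarrow> L b = F (w b)"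
    using TW.linear_independent_extend[OF B(2), of "\<lambda>b. F (w b)"] by blast
  have "L (tensor s xs) = F xs" if len: "length xs = n" for xs
  proof (rule ccontr)
    assume neq: "L (tensor s xs) \<noteq> F xs"
    let ?d = "L (tensor s xs) - F xs"
    have "W.independent {?d}"
      using neq by (simp add: W.dependent_single)
    then obtain g where g: "Vector_Spaces.linear s' (*) g" "g ?d = (1::'k)"
      using WK.linear_independent_extend[of "{?d}" "\<lambda>_. 1"] by auto
    have g0: "g 0 = 0"
      using g(1) by (rule linear_zeroD)
    let ?\<phi> = "\<lambda>xs. if length xs = n then g (F xs) else 0"
    have "multilinear s (*) ?\<phi>"
      unfolding multilinear_def
    proof (intro allI)
      fix xs ys
      show "Vector_Spaces.linear s (*) (\<lambda>x. ?\<phi> (xs @ x # ys))"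
      proof (cases "length xs + length ys + 1 = n")
        case True
        then show ?thesis
          using linear_comp[OF lin[OF True] g(1)] by auto
      next
        case False
        then show ?thesis
          by (intro linearI assms vector_space_times) auto
      qed
    qed
    then have ev: "tensor s zs ?\<phi> = g (F zs)" if "length zs = n" for zs
      using that by (simp add: tensor_def)
    have "t ?\<phi> = g (L t)" if "t \<in> T.span B" for t
      using that
    proof (induction rule: T.span_induct_alt)
      case base
      then show ?case
        using linear_zeroD[OF L(1)] g0 by (simp add: zero_fun_def)
    next
      case (step c b t)
      have "b ?\<phi> = g (L b)"
        using ev[of "w b"] w[OF step(1)] L(2)[OF step(1)] by simp
      then have "(tscale c b + t) ?\<phi> = c * g (L b) + g (L t)"
        using step(2) by (simp add: tscale_def)
      also have "\<dots> = g (L (tscale c b + t))"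
        by (simp only: linear_addD[OF L(1)] linear_scaleD[OF L(1)]
            linear_addD[OF g(1)] linear_scaleD[OF g(1)])
      finally show ?case .
    qed
    moreover have "tensor s xs \<in> T.span B"
      using B(3) len by blast
    ultimately have "g (L (tensor s xs)) = g (F xs)"
      using ev[OF len] by auto
    moreover have "g (L (tensor s xs)) = g ?d + g (F xs)"
      using linear_addD[OF g(1), of ?d "F xs"] by simp
    ultimately show False
      using g(2) by simp
  qed
  then show ?thesis
    using L(1) by blast
qed

lemma tensor_power_unique:
  fixes s :: "'k::field \<Rightarrow> 'a::ab_group_add \<Rightarrow> 'a"
  assumes "Vector_Spaces.linear tscale s' L" "Vector_Spaces.linear tscale s' L'"
    and "\<And>xs. length xs = n \<Longrightarrow> L (tensor s xs) = L' (tensor s xs)"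
    and "t \<in> tensor_power s n"
  shows "L t = L' t"
proof -
  interpret T: vector_space "tscale :: 'k \<Rightarrow> ('k, 'a) tensor \<Rightarrow> _"
    by (rule vector_space_tscale)
  interpret W: vector_space s'
    using assms(1) by (rule linear_spacesD)
  show ?thesis
    using assms(4) unfolding tensor_power_def
  proof (induction rule: T.span_induct_alt)
    case base
    then show ?case
      using linear_zeroD[OF assms(1)] linear_zeroD[OF assms(2)] by (simp add: zero_fun_def)
  next
    case (step c b t)
    then have "L b = L' b"
      using assms(3) by auto
    then have "L (tscale c b + t) = L' (tscale c b + t)"
      using step(2) by (simp only: linear_addD[OF assms(1)] linear_scaleD[OF assms(1)]
          linear_addD[OF assms(2)] linear_scaleD[OF assms(2)])
    then show ?case .
  qed
qed

section \<open>$\epsilon$-Hom-bialgebras\<close>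

text \<open>
  For linear maps $f \colon A \to A^{\otimes p}$ and $g \colon A \to A^{\otimes q}$, this is
  $f \otimes g \colon A^{\otimes 2} \to A^{\otimes (p+q)}$.  A map $A \to A$ enters it as
  \<open>\<lambda>x. tensor s [\<alpha> x]\<close>, the identification of $A$ with $A^{\otimes 1}$.
\<close>

definition tensor_map2 ::
  "('k::field \<Rightarrow> 'a::ab_group_add \<Rightarrow> 'a) \<Rightarrow> ('a \<Rightarrow> ('k, 'a) tensor) \<Rightarrow> ('a \<Rightarrow> ('k, 'a) tensor) \<Rightarrow>
    ('k, 'a) tensor \<Rightarrow> ('k, 'a) tensor"
  where "tensor_map2 s f g = tensor_lift2 (\<lambda>x y. tensor_times s (f x) (g y))"

abbreviation alpha_tensor_Delta where
  "alpha_tensor_Delta s \<Delta> \<alpha> \<equiv> tensor_map2 s (\<lambda>x. tensor s [\<alpha> x]) \<Delta>"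

abbreviation Delta_tensor_alpha where
  "Delta_tensor_alpha s \<Delta> \<alpha> \<equiv> tensor_map2 s \<Delta> (\<lambda>x. tensor s [\<alpha> x])"

definition mu_tensor_alpha ::
  "('k::field \<Rightarrow> 'a::ab_group_add \<Rightarrow> 'a) \<Rightarrow> ('a \<Rightarrow> 'a \<Rightarrow> 'a) \<Rightarrow> ('a \<Rightarrow> 'a) \<Rightarrow>
    ('k, 'a) tensor \<Rightarrow> ('k, 'a) tensor"
  where "mu_tensor_alpha s \<mu> \<alpha> = tensor_lift3 (\<lambda>x y z. tensor s [\<mu> x y, \<alpha> z])"

definition alpha_tensor_mu ::
  "('k::field \<Rightarrow> 'a::ab_group_add \<Rightarrow> 'a) \<Rightarrow> ('a \<Rightarrow> 'a \<Rightarrow> 'a) \<Rightarrow> ('a \<Rightarrow> 'a) \<Rightarrow>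
    ('k, 'a) tensor \<Rightarrow> ('k, 'a) tensor"
  where "alpha_tensor_mu s \<mu> \<alpha> = tensor_lift3 (\<lambda>x y z. tensor s [\<alpha> x, \<mu> y z])"

definition alpha_tensor_alpha ::
  "('k::field \<Rightarrow> 'a::ab_group_add \<Rightarrow> 'a) \<Rightarrow> ('a \<Rightarrow> 'a) \<Rightarrow> ('k, 'a) tensor \<Rightarrow> ('k, 'a) tensor"
  where "alpha_tensor_alpha s \<alpha> = tensor_lift2 (\<lambda>x y. tensor s [\<alpha> x, \<alpha> y])"

text \<open>
  The multiplication $A^{\otimes 2} \to A$ is given as a curried bilinear map, so identities between
  linear maps on $A^{\otimes 2}$ or $A^{\otimes 3}$ that start with \<open>\<mu>\<close> are stated on pure tensors.
\<close>

locale eps_hom_bialgebra = vector_space scale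
  for scale :: "'k::field_char_0 \<Rightarrow> 'a::ab_group_add \<Rightarrow> 'a" +
  fixes \<mu> :: "'a \<Rightarrow> 'a \<Rightarrow> 'a"
    and \<Delta> :: "'a \<Rightarrow> ('k, 'a) tensor"
    and \<alpha> :: "'a \<Rightarrow> 'a"
  assumes linear_mu_left: "Vector_Spaces.linear scale scale (\<lambda>x. \<mu> x y)"
    and linear_mu_right: "Vector_Spaces.linear scale scale (\<lambda>y. \<mu> x y)"
    and linear_Delta: "Vector_Spaces.linear scale tscale \<Delta>"
    and Delta_in: "\<Delta> x \<in> tensor_power scale 2"
    and linear_alpha: "Vector_Spaces.linear scale scale \<alpha>"
    and alpha_mu: "\<alpha> (\<mu> x y) = \<mu> (\<alpha> x) (\<alpha> y)"
    and hom_assoc: "\<mu> (\<alpha> x) (\<mu> y z) = \<mu> (\<mu> x y) (\<alpha> z)"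
    and alpha_Delta: "alpha_tensor_alpha scale \<alpha> (\<Delta> x) = \<Delta> (\<alpha> x)"
    and hom_coassoc:
      "alpha_tensor_Delta scale \<Delta> \<alpha> (\<Delta> x) = Delta_tensor_alpha scale \<Delta> \<alpha> (\<Delta> x)"
    and Delta_mu: "\<Delta> (\<mu> x y) =
      mu_tensor_alpha scale \<mu> \<alpha> (alpha_tensor_Delta scale \<Delta> \<alpha> (tensor scale [x, y])) +
      alpha_tensor_mu scale \<mu> \<alpha> (Delta_tensor_alpha scale \<Delta> \<alpha> (tensor scale [x, y]))"

section \<open>Perturbation by a 2-tensor\<close>

definition alpha_invariant ::
  "('k::field \<Rightarrow> 'a::ab_group_add \<Rightarrow> 'a) \<Rightarrow> ('a \<Rightarrow> 'a) \<Rightarrow> ('k, 'a) tensor \<Rightarrow> bool"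
  where "alpha_invariant s \<alpha> r \<longleftrightarrow> alpha_tensor_alpha s \<alpha> r = r"

definition bracket_star ::
  "('k::field \<Rightarrow> 'a::ab_group_add \<Rightarrow> 'a) \<Rightarrow> ('a \<Rightarrow> 'a \<Rightarrow> 'a) \<Rightarrow> ('a \<Rightarrow> 'a) \<Rightarrow>
    'a \<Rightarrow> ('k, 'a) tensor \<Rightarrow> ('k, 'a) tensor"
  where "bracket_star s \<mu> \<alpha> a =
    tensor_lift2 (\<lambda>u v. tensor s [\<mu> a u, \<alpha> v] - tensor s [\<alpha> u, \<mu> v a])"

definition bracket_bullet ::
  "('k::field \<Rightarrow> 'a::ab_group_add \<Rightarrow> 'a) \<Rightarrow> ('a \<Rightarrow> 'a \<Rightarrow> 'a) \<Rightarrow> ('a \<Rightarrow> 'a) \<Rightarrow>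
    'a \<Rightarrow> ('k, 'a) tensor \<Rightarrow> ('k, 'a) tensor"
  where "bracket_bullet s \<mu> \<alpha> a =
    tensor_lift (\<lambda>bs. tensor s (\<mu> (\<alpha> a) (hd bs) # map \<alpha> (tl bs)) -
      tensor s (map \<alpha> (butlast bs) @ [\<mu> (last bs) (\<alpha> a)]))"

definition alpha_tensor_Delta_minus ::
  "('k::field \<Rightarrow> 'a::ab_group_add \<Rightarrow> 'a) \<Rightarrow> ('a \<Rightarrow> ('k, 'a) tensor) \<Rightarrow> ('a \<Rightarrow> 'a) \<Rightarrow>
    ('k, 'a) tensor \<Rightarrow> ('k, 'a) tensor"
  where "alpha_tensor_Delta_minus s \<Delta> \<alpha> t =
    alpha_tensor_Delta s \<Delta> \<alpha> t - Delta_tensor_alpha s \<Delta> \<alpha> t"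

definition prod_13_12 ::
  "('k::field \<Rightarrow> 'a::ab_group_add \<Rightarrow> 'a) \<Rightarrow> ('a \<Rightarrow> 'a \<Rightarrow> 'a) \<Rightarrow> ('a \<Rightarrow> 'a) \<Rightarrow>
    ('k, 'a) tensor \<Rightarrow> ('k, 'a) tensor \<Rightarrow> ('k, 'a) tensor"
  where "prod_13_12 s \<mu> \<alpha> r r' =
    tensor_lift2 (\<lambda>u v. tensor_lift2 (\<lambda>u' v'. tensor s [\<mu> u u', \<alpha> v', \<alpha> v]) r') r"

definition prod_12_23 ::
  "('k::field \<Rightarrow> 'a::ab_group_add \<Rightarrow> 'a) \<Rightarrow> ('a \<Rightarrow> 'a \<Rightarrow> 'a) \<Rightarrow> ('a \<Rightarrow> 'a) \<Rightarrow>
    ('k, 'a) tensor \<Rightarrow> ('k, 'a) tensor \<Rightarrow> ('k, 'a) tensor"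
  where "prod_12_23 s \<mu> \<alpha> r r' =
    tensor_lift2 (\<lambda>u v. tensor_lift2 (\<lambda>u' v'. tensor s [\<alpha> u, \<mu> v u', \<alpha> v']) r') r"

definition prod_23_13 ::
  "('k::field \<Rightarrow> 'a::ab_group_add \<Rightarrow> 'a) \<Rightarrow> ('a \<Rightarrow> 'a \<Rightarrow> 'a) \<Rightarrow> ('a \<Rightarrow> 'a) \<Rightarrow>
    ('k, 'a) tensor \<Rightarrow> ('k, 'a) tensor \<Rightarrow> ('k, 'a) tensor"
  where "prod_23_13 s \<mu> \<alpha> r r' =
    tensor_lift2 (\<lambda>u v. tensor_lift2 (\<lambda>u' v'. tensor s [\<alpha> u', \<alpha> u, \<mu> v v']) r') r"

text \<open>The 3-tensor $A(r)$.\<close>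

definition A_tensor ::
  "('k::field \<Rightarrow> 'a::ab_group_add \<Rightarrow> 'a) \<Rightarrow> ('a \<Rightarrow> 'a \<Rightarrow> 'a) \<Rightarrow> ('a \<Rightarrow> 'a) \<Rightarrow>
    ('k, 'a) tensor \<Rightarrow> ('k, 'a) tensor"
  where "A_tensor s \<mu> \<alpha> r =
    prod_13_12 s \<mu> \<alpha> r r - prod_12_23 s \<mu> \<alpha> r r + prod_23_13 s \<mu> \<alpha> r r"

definition Delta_perturbed ::
  "('k::field \<Rightarrow> 'a::ab_group_add \<Rightarrow> 'a) \<Rightarrow> ('a \<Rightarrow> 'a \<Rightarrow> 'a) \<Rightarrow> ('a \<Rightarrow> ('k, 'a) tensor) \<Rightarrow>
    ('a \<Rightarrow> 'a) \<Rightarrow> ('k, 'a) tensor \<Rightarrow> 'a \<Rightarrow> ('k, 'a) tensor"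
  where "Delta_perturbed s \<mu> \<Delta> \<alpha> r a = \<Delta> a + bracket_star s \<mu> \<alpha> a r"

end

theory Submission
  imports Defs
begin

text \<open>
  Write \<open>D\<close> for the bracket $a \mapsto [a,r]_*$ and $J(\delta) = \alpha \otimes \delta - \delta \otimes \alpha$
  for the defect of Hom-coassociativity.  All axioms of $A'$ except Hom-coassociativity hold because
  \<open>r\<close> is $\alpha$-invariant and \<open>\<mu>\<close> is Hom-associative.  Since $J(\Delta)(\Delta(a)) = 0$, what remains of
  $J(\Delta + D)(\Delta(a) + D(a))$ is the sum of
  \<^item> $J(\Delta)(D(a)) = [a, J(\Delta)(r)]_\bullet - \Delta(a)_{12} r_{23} - r_{12} \Delta(a)_{23}$,
    from the expansion of $\Delta \circ \mu$;
  \<^item> $J(D)(\Delta(a)) = \Delta(a)_{12} r_{23} + r_{12} \Delta(a)_{23} - r_{23} \Delta(a)_{13} - \Delta(a)_{13} r_{12}$;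
  \<^item> $J(D)(D(a)) = -[a, A(r)]_\bullet$: the second identity holds with any 2-tensor in place of
    $\Delta(a)$, and for $D(a)$ two of its eight double sums cancel.
\<close>

section \<open>Linear extensions and linear maps into tensors\<close>

interpretation tensor_space: vector_space "tscale :: 'k::field \<Rightarrow> ('k, 'a) tensor \<Rightarrow> _"
  by (rule vector_space_tscale)

lemma tensor_lift_zero [simp]: "tensor_lift F 0 = (0 :: ('k::field, 'b) tensor)"
  and tensor_lift_add: "tensor_lift F (t + t') = tensor_lift F t + tensor_lift F t'"
  and tensor_lift_diff: "tensor_lift F (t - t') = tensor_lift F t - tensor_lift F t'"
  and tensor_lift_tscale: "tensor_lift F (tscale c t) = tscale c (tensor_lift F t)"
  by (simp_all add: tensor_lift_def tscale_def fun_eq_iff)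

lemma tensor_lift_sum:
  fixes F :: "'a list \<Rightarrow> ('k::field, 'b) tensor"
  shows "tensor_lift F (sum t I) = (\<Sum>i\<in>I. tensor_lift F (t i))"
  using linear_tensor_lift[of F] module_hom.sum unfolding Vector_Spaces.linear_def by blast

text \<open>The two- and three-letter lifts are \<open>tensor_lift\<close> at a case distinction, so
  their distributive laws come from instantiating the general ones and folding the definitions
  back.\<close>

lemmas tensor_lift2_add = tensor_lift_add[of "\<lambda>xs. case xs of [x, y] \<Rightarrow> f x y | _ \<Rightarrow> 0" for f,
    folded tensor_lift2_def]
lemmas tensor_lift2_diff = tensor_lift_diff[of "\<lambda>xs. case xs of [x, y] \<Rightarrow> f x y | _ \<Rightarrow> 0" for f,
    folded tensor_lift2_def]
lemmas tensor_lift2_sum = tensor_lift_sum[of "\<lambda>xs. case xs of [x, y] \<Rightarrow> f x y | _ \<Rightarrow> 0" for f,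
    folded tensor_lift2_def]
lemmas tensor_lift3_add = tensor_lift_add[of "\<lambda>xs. case xs of [x, y, z] \<Rightarrow> f x y z | _ \<Rightarrow> 0" for f,
    folded tensor_lift3_def]
lemmas tensor_lift3_diff = tensor_lift_diff[of "\<lambda>xs. case xs of [x, y, z] \<Rightarrow> f x y z | _ \<Rightarrow> 0" for f,
    folded tensor_lift3_def]
lemmas tensor_lift3_sum = tensor_lift_sum[of "\<lambda>xs. case xs of [x, y, z] \<Rightarrow> f x y z | _ \<Rightarrow> 0" for f,
    folded tensor_lift3_def]

lemmas tensor_lift_distribs = tensor_lift_add tensor_lift_diff tensor_lift_sum
  tensor_lift2_add tensor_lift2_diff tensor_lift2_sum
  tensor_lift3_add tensor_lift3_diff tensor_lift3_sum

lemma linear_add: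
  assumes "Vector_Spaces.linear s s' f" "Vector_Spaces.linear s s' g"
  shows "Vector_Spaces.linear s s' (\<lambda>x. f x + g x)"
  using linear_spacesD[OF assms(1)]
  by (intro linearI)
    (simp_all add: linear_addD[OF assms(1)] linear_addD[OF assms(2)] linear_scaleD[OF assms(1)]
      linear_scaleD[OF assms(2)] module.scale_right_distrib module_iff_vector_space)

lemma linear_diff:
  assumes "Vector_Spaces.linear s s' f" "Vector_Spaces.linear s s' g"
  shows "Vector_Spaces.linear s s' (\<lambda>x. f x - g x)"
  using linear_spacesD[OF assms(1)]
  by (intro linearI)
    (simp_all add: linear_addD[OF assms(1)] linear_addD[OF assms(2)] linear_scaleD[OF assms(1)]
      linear_scaleD[OF assms(2)] module.scale_right_diff_distrib module_iff_vector_space)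

lemma linear_sum:
  assumes "vector_space s" "vector_space s'" "\<And>i. Vector_Spaces.linear s s' (f i)"
  shows "Vector_Spaces.linear s s' (\<lambda>x. \<Sum>i\<in>I. f i x)"
  using assms(1,2)
  by (intro linearI)
    (simp_all add: linear_addD[OF assms(3)] linear_scaleD[OF assms(3)] sum.distrib
      module.scale_sum_right module_iff_vector_space)

abbreviation lin :: "('k::field \<Rightarrow> 'a::ab_group_add \<Rightarrow> 'a) \<Rightarrow> ('a \<Rightarrow> ('k, 'b) tensor) \<Rightarrow> bool"
  where "lin s \<equiv> Vector_Spaces.linear s tscale"

text \<open>Words of all lengths together: the span in which the range condition of
  \<open>tensor_lift_tensor\<close> is phrased.\<close>

abbreviation tensors :: "('k::field \<Rightarrow> 'a::ab_group_add \<Rightarrow> 'a) \<Rightarrow> ('k, 'a) tensor set"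
  where "tensors s \<equiv> tensor_space.span (range (tensor s))"

text \<open>Multiplication by a single letter, as one lift instead of the two nested lifts of
  \<open>tensor_times\<close>. With \<open>snoc_tensor\<close> it describes \<alpha> \<otimes> D and
  D \<otimes> \<alpha> on pure tensors.\<close>

definition cons_tensor ::
  "('k::field \<Rightarrow> 'a::ab_group_add \<Rightarrow> 'a) \<Rightarrow> 'a \<Rightarrow> ('k, 'a) tensor \<Rightarrow> ('k, 'a) tensor"
  where "cons_tensor s a = tensor_lift (\<lambda>ws. tensor s (a # ws))"

definition snoc_tensor ::
  "('k::field \<Rightarrow> 'a::ab_group_add \<Rightarrow> 'a) \<Rightarrow> ('k, 'a) tensor \<Rightarrow> 'a \<Rightarrow> ('k, 'a) tensor"
  where "snoc_tensor s t b = tensor_lift (\<lambda>ws. tensor s (ws @ [b])) t"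

section \<open>Evaluation on words, one-letter factors and sums of pure 2-tensors\<close>

context vector_space
begin

lemma linear_tensor:
  assumes "Vector_Spaces.linear scale scale f"
  shows "lin scale (\<lambda>x. tensor scale (xs @ f x # ys))"
  using linear_comp[OF assms, of tscale "\<lambda>x. tensor scale (xs @ x # ys)"]
    multilinear_tensor[OF vector_space_axioms]
  by (simp add: multilinear_def)

lemmas linear_tensor_words =
  linear_tensor[where xs = "[]" and ys = "[b]" for b, simplified]
  linear_tensor[where xs = "[a]" and ys = "[]" for a, simplified]
  linear_tensor[where xs = "[]" and ys = "[b, c]" for b c, simplified]
  linear_tensor[where xs = "[a]" and ys = "[c]" for a c, simplified]
  linear_tensor[where xs = "[a, b]" and ys = "[]" for a b, simplified]

lemmas tensor_in_tensors = tensor_in_span[of scale]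

lemmas lin_sum = linear_sum[OF vector_space_axioms vector_space_tscale]

text \<open>Source and target space coincide here, so no scalar multiplication is left to be guessed
  when this serves as a rewrite rule.\<close>

lemma lift2_tensor:
  assumes "\<And>y. lin scale (\<lambda>x. f x y)" "\<And>x. lin scale (\<lambda>y. f x y)" "\<And>x y. f x y \<in> tensors scale"
  shows "tensor_lift2 f (tensor scale [x, y]) = f x y"
  using assms by (rule tensor_lift2_tensor)

text \<open>Extension by zero to words of other lengths stays multilinear: inserting a letter
  between fixed \<open>xs\<close> and \<open>ys\<close> produces words of one length only.\<close>

lemma lift3_tensor:
  assumes f: "\<And>y z. lin scale (\<lambda>x. f x y z)" "\<And>x z. lin scale (\<lambda>y. f x y z)" "\<And>x y. lin scale (\<lambda>z. f x y z)"
    and f_in: "\<And>x y z. f x y z \<in> tensors scale"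
  shows "tensor_lift3 f (tensor scale [x, y, z]) = f x y z"
proof -
  let ?F = "\<lambda>xs. case xs of [x, y, z] \<Rightarrow> f x y z | _ \<Rightarrow> 0"
  have zero: "lin scale (\<lambda>x. 0)"
    by (intro linearI vector_space_axioms vector_space_tscale) simp_all
  have "multilinear scale tscale ?F"
    unfolding multilinear_def
  proof (intro allI)
    fix xs ys :: "'b list"
    consider y z where "xs = []" "ys = [y, z]" | x z where "xs = [x]" "ys = [z]"
      | x y where "xs = [x, y]" "ys = []" | "length (xs @ ys) \<noteq> 2"
      by (cases xs; cases ys; cases "tl xs"; cases "tl ys"; cases "tl (tl xs)";
          cases "tl (tl ys)") auto
    then show "lin scale (\<lambda>x. ?F (xs @ x # ys))"
    proof cases
      case 4
      have "?F zs = 0" if "length zs \<noteq> 3" for zs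
        using that by (auto split: list.split)
      then have "(\<lambda>x. ?F (xs @ x # ys)) = (\<lambda>x. 0)"
        using 4 by (intro ext) simp
      then show ?thesis
        using zero by simp
    qed (use f in simp_all)
  qed
  moreover have "range ?F \<subseteq> tensors scale"
    using f_in tensor_space.span_zero by (auto split: list.split)
  ultimately show ?thesis
    by (simp add: tensor_lift3_def tensor_lift_tensor)
qed

text \<open>Linearity in a parameter of the lifted map, not in the tensor. For a word
  \<open>t\<close> it is the hypothesis \<open>lin\<close>; both sides of each identity are linear
  in \<open>t\<close>, so it spreads over the span.\<close>

lemma lin_tensor_lift_param:
  assumes t: "t \<in> tensors scale"
    and F: "\<And>x. multilinear scale tscale (\<lambda>ws. F ws x)" "\<And>x. range (\<lambda>ws. F ws x) \<subseteq> tensors scale"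
    and lin: "\<And>ws. lin scale (F ws)"
  shows "lin scale (\<lambda>x. tensor_lift (\<lambda>ws. F ws x) t)"
proof (intro linearI vector_space_axioms vector_space_tscale)
  have word: "tensor_lift (\<lambda>ws. F ws x) (tensor scale ws) = F ws x" for ws x
    using F by (rule tensor_lift_tensor)
  show "tensor_lift (\<lambda>ws. F ws (x + y)) t =
      tensor_lift (\<lambda>ws. F ws x) t + tensor_lift (\<lambda>ws. F ws y) t" for x y
  proof (rule tensor_space.span_induct_alt[OF t])
    fix c b t
    assume "b \<in> range (tensor scale)" "tensor_lift (\<lambda>ws. F ws (x + y)) t =
      tensor_lift (\<lambda>ws. F ws x) t + tensor_lift (\<lambda>ws. F ws y) t"
    then show "tensor_lift (\<lambda>ws. F ws (x + y)) (tscale c b + t) =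
      tensor_lift (\<lambda>ws. F ws x) (tscale c b + t) + tensor_lift (\<lambda>ws. F ws y) (tscale c b + t)"
      by (elim imageE, simp only: word tensor_lift_add tensor_lift_tscale)
        (simp add: linear_addD[OF lin]
          tensor_space.scale_right_distrib)
  next
    show "tensor_lift (\<lambda>ws. F ws (x + y)) 0 =
        tensor_lift (\<lambda>ws. F ws x) 0 + tensor_lift (\<lambda>ws. F ws y) 0"
      by simp
  qed
  show "tensor_lift (\<lambda>ws. F ws (scale c x)) t = tscale c (tensor_lift (\<lambda>ws. F ws x) t)" for c x
  proof (rule tensor_space.span_induct_alt[OF t])
    fix d b t
    assume "b \<in> range (tensor scale)"
      "tensor_lift (\<lambda>ws. F ws (scale c x)) t = tscale c (tensor_lift (\<lambda>ws. F ws x) t)"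
    then show "tensor_lift (\<lambda>ws. F ws (scale c x)) (tscale d b + t) =
      tscale c (tensor_lift (\<lambda>ws. F ws x) (tscale d b + t))"
      by (elim imageE, simp only: word tensor_lift_add tensor_lift_tscale)
        (simp add: linear_scaleD[OF lin]
          tensor_space.scale_right_distrib tensor_space.scale_left_commute)
  next
    show "tensor_lift (\<lambda>ws. F ws (scale c x)) 0 = tscale c (tensor_lift (\<lambda>ws. F ws x) 0)"
      by simp
  qed
qed

lemma tensor_lift_in_tensors:
  assumes t: "t \<in> tensors scale" and F: "multilinear scale tscale F" "range F \<subseteq> tensors scale"
  shows "tensor_lift F t \<in> tensors scale"
proof (rule tensor_space.span_induct_alt[OF t])
  fix c b t
  assume "b \<in> range (tensor scale)" "tensor_lift F t \<in> tensors scale"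
  then show "tensor_lift F (tscale c b + t) \<in> tensors scale"
    using F
    by (auto simp: tensor_lift_add tensor_lift_tscale tensor_lift_tensor[OF F]
        intro!: tensor_space.span_add tensor_space.span_scale)
qed (simp add: tensor_space.span_zero flip: zero_fun_def)

lemma multilinear_append:
  "multilinear scale tscale (\<lambda>ws. tensor scale (xs @ ws))"
  "multilinear scale tscale (\<lambda>ws. tensor scale (ws @ xs))"
  using linear_tensor[OF linear_ident, of "xs @ _"] linear_tensor[OF linear_ident, of _ "_ @ xs"]
  by (simp_all add: multilinear_def)

lemma multilinear_Cons: "multilinear scale tscale (\<lambda>ws. tensor scale (a # ws))"
  using multilinear_append(1)[of "[a]"] by simp

lemma cons_tensor_tensor [simp]: "cons_tensor scale a (tensor scale ws) = tensor scale (a # ws)"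
  unfolding cons_tensor_def
  by (rule tensor_lift_tensor[OF multilinear_Cons]) (auto intro: tensor_in_tensors)

lemma snoc_tensor_tensor [simp]: "snoc_tensor scale (tensor scale ws) b = tensor scale (ws @ [b])"
  unfolding snoc_tensor_def
  by (rule tensor_lift_tensor[OF multilinear_append(2)]) (auto intro: tensor_in_tensors)

lemma cons_tensor_distribs:
  "cons_tensor scale a (t + t') = cons_tensor scale a t + cons_tensor scale a t'"
  "cons_tensor scale a (t - t') = cons_tensor scale a t - cons_tensor scale a t'"
  "cons_tensor scale a (sum g I) = (\<Sum>i\<in>I. cons_tensor scale a (g i))"
  by (simp_all add: cons_tensor_def tensor_lift_distribs)

lemma snoc_tensor_distribs:
  "snoc_tensor scale (t + t') b = snoc_tensor scale t b + snoc_tensor scale t' b"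
  "snoc_tensor scale (t - t') b = snoc_tensor scale t b - snoc_tensor scale t' b"
  "snoc_tensor scale (sum g I) b = (\<Sum>i\<in>I. snoc_tensor scale (g i) b)"
  by (simp_all add: snoc_tensor_def tensor_lift_distribs)

text \<open>The outer lift is the one that meets a word, so the inner lift of \<open>t\<close> has
  to be multilinear in the prefix, which is an instance of
  \<open>lin_tensor_lift_param\<close>.\<close>

lemma tensor_times_cons:
  assumes "t \<in> tensors scale"
  shows "tensor_times scale (tensor scale [a]) t = cons_tensor scale a t"
proof -
  have "multilinear scale tscale (\<lambda>xs. tensor_lift (\<lambda>ws. tensor scale (xs @ ws)) t)"
    unfolding multilinear_def
    by (intro allI lin_tensor_lift_param[OF assms] multilinear_append)
      (auto intro: tensor_in_tensors linear_tensor[OF linear_ident])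
  then show ?thesis
    unfolding tensor_times_def cons_tensor_def
    by (subst tensor_lift_tensor[where s' = scale])
      (auto intro!: tensor_lift_in_tensors assms multilinear_append tensor_in_tensors)
qed

text \<open>Here the inner lift meets the word, so it collapses for every prefix before the lift
  over \<open>t\<close> is touched.\<close>

lemma tensor_times_snoc: "tensor_times scale t (tensor scale [b]) = snoc_tensor scale t b"
proof -
  have "tensor_lift (\<lambda>ys. tensor scale (xs @ ys)) (tensor scale [b]) = tensor scale (xs @ [b])" for xs
    by (rule tensor_lift_tensor[OF multilinear_append(1)]) (auto intro: tensor_in_tensors)
  then show ?thesis
    by (simp add: tensor_times_def snoc_tensor_def)
qed

lemma tensor_power_tensors: "t \<in> tensor_power scale n \<Longrightarrow> t \<in> tensors scale"
  using tensor_power_subset by blast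

lemma tensor_in_power2 [simp]: "tensor scale [x, y] \<in> tensor_power scale 2"
  unfolding tensor_power_def by (intro tensor_space.span_base CollectI exI[of _ "[x, y]"]) simp

text \<open>A scalar can be absorbed into the first letter, so linear combinations of pure tensors
  are plain sums of them. This reduces tensor identities to manipulations of finite sums.\<close>

lemma tensor_power2_cases:
  assumes "t \<in> tensor_power scale 2"
  obtains n :: nat and x y where "t = (\<Sum>i<n. tensor scale [x i, y i])"
proof -
  have "\<exists>(n::nat) x y. t = (\<Sum>i<n. tensor scale [x i, y i])"
    using assms unfolding tensor_power_def
  proof (induction rule: tensor_space.span_induct_alt)
    case base
    show ?case by (rule exI[of _ 0]) (simp add: zero_fun_def)
  next
    case (step c b t)
    then obtain n :: nat and x y where t: "t = (\<Sum>i<n. tensor scale [x i, y i])" by blast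
    from step(1) obtain a a' where b: "b = tensor scale [a, a']"
      by (auto simp: numeral_2_eq_2 length_Suc_conv)
    have "tscale c b = tensor scale [scale c a, a']"
      using linear_scaleD[OF linear_tensor_words(1)[OF linear_ident]] by (simp add: b)
    \<comment> \<open>The updates at \<open>n\<close> do not affect the summands with index below
      \<open>n\<close>.\<close>
    then have "tscale c b + t = (\<Sum>i<Suc n. tensor scale [(x(n := scale c a)) i, (y(n := a')) i])"
      by (simp add: t add.commute)
    then show ?case by blast
  qed
  then show ?thesis using that by blast
qed

lemma lin_cons_tensor:
  assumes "t \<in> tensors scale" "Vector_Spaces.linear scale scale g"
  shows "lin scale (\<lambda>x. cons_tensor scale (g x) t)"
  unfolding cons_tensor_def
  by (intro lin_tensor_lift_param assms multilinear_Cons)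
    (auto intro: tensor_in_tensors linear_tensor[OF assms(2), of "[]", simplified])

lemma lin_snoc_tensor:
  assumes "t \<in> tensors scale" "Vector_Spaces.linear scale scale g"
  shows "lin scale (\<lambda>x. snoc_tensor scale t (g x))"
  unfolding snoc_tensor_def
  by (intro lin_tensor_lift_param assms multilinear_append)
    (auto intro: tensor_in_tensors linear_tensor[OF assms(2), of _ "[]", simplified])

lemma lin_cons_tensor_comp: "lin scale f \<Longrightarrow> lin scale (\<lambda>x. cons_tensor scale a (f x))"
  unfolding cons_tensor_def by (rule linear_comp[OF _ linear_tensor_lift])

lemma lin_snoc_tensor_comp: "lin scale f \<Longrightarrow> lin scale (\<lambda>x. snoc_tensor scale (f x) b)"
  unfolding snoc_tensor_def by (rule linear_comp[OF _ linear_tensor_lift])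

lemma cons_tensor_in_tensors: "t \<in> tensors scale \<Longrightarrow> cons_tensor scale a t \<in> tensors scale"
  unfolding cons_tensor_def
  by (auto intro!: tensor_lift_in_tensors multilinear_Cons tensor_in_tensors)

lemma snoc_tensor_in_tensors: "t \<in> tensors scale \<Longrightarrow> snoc_tensor scale t b \<in> tensors scale"
  unfolding snoc_tensor_def
  by (auto intro!: tensor_lift_in_tensors multilinear_append tensor_in_tensors)

lemmas lin_simps = linear_ident linear_tensor_words lin_cons_tensor lin_snoc_tensor
  lin_cons_tensor_comp lin_snoc_tensor_comp linear_add linear_diff lin_sum

lemmas in_tensors_simps = tensor_in_tensors cons_tensor_in_tensors snoc_tensor_in_tensors
  tensor_space.span_add tensor_space.span_diff tensor_space.span_sum

text \<open>Kept general in \<open>D\<close>, since it is needed for \<open>\<Delta>\<close>, for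
  the bracket with \<open>r\<close> and for their sum.\<close>

lemma alpha_tensor_Delta_tensor:
  assumes "lin scale D" "\<And>x. D x \<in> tensors scale" "Vector_Spaces.linear scale scale \<alpha>"
  shows "alpha_tensor_Delta scale D \<alpha> (tensor scale [x, y]) = cons_tensor scale (\<alpha> x) (D y)"
  by (simp add: tensor_map2_def tensor_times_cons lift2_tensor assms lin_simps in_tensors_simps)

lemma Delta_tensor_alpha_tensor:
  assumes "lin scale D" "\<And>x. D x \<in> tensors scale" "Vector_Spaces.linear scale scale \<alpha>"
  shows "Delta_tensor_alpha scale D \<alpha> (tensor scale [x, y]) = snoc_tensor scale (D x) (\<alpha> y)"
  by (simp add: tensor_map2_def tensor_times_snoc lift2_tensor assms lin_simps in_tensors_simps)

end

section \<open>Structure maps, brackets and products on sums of pure tensors\<close>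

context eps_hom_bialgebra
begin

lemma linear_mu_alpha_comp:
  assumes "Vector_Spaces.linear scale scale g"
  shows "Vector_Spaces.linear scale scale (\<lambda>x. \<mu> (g x) y)"
    and "Vector_Spaces.linear scale scale (\<lambda>x. \<mu> y (g x))"
    and "Vector_Spaces.linear scale scale (\<lambda>x. \<alpha> (g x))"
  by (rule linear_comp[OF assms] linear_mu_left linear_mu_right linear_alpha)+

lemmas word_simps = linear_mu_alpha_comp lin_simps in_tensors_simps

lemma mu_tensor_alpha_tensor:
  "mu_tensor_alpha scale \<mu> \<alpha> (tensor scale [x, y, z]) = tensor scale [\<mu> x y, \<alpha> z]"
  by (simp add: mu_tensor_alpha_def lift3_tensor word_simps)

lemma alpha_tensor_mu_tensor:
  "alpha_tensor_mu scale \<mu> \<alpha> (tensor scale [x, y, z]) = tensor scale [\<alpha> x, \<mu> y z]"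
  by (simp add: alpha_tensor_mu_def lift3_tensor word_simps)

lemma alpha_tensor_alpha_tensor:
  "alpha_tensor_alpha scale \<alpha> (tensor scale [x, y]) = tensor scale [\<alpha> x, \<alpha> y]"
  by (simp add: alpha_tensor_alpha_def lift2_tensor word_simps)

lemma bracket_star_tensor:
  "bracket_star scale \<mu> \<alpha> a (tensor scale [x, y]) =
    tensor scale [\<mu> a x, \<alpha> y] - tensor scale [\<alpha> x, \<mu> y a]"
  unfolding bracket_star_def by (subst lift2_tensor) (simp_all add: word_simps)

lemma bracket_bullet_tensor:
  "bracket_bullet scale \<mu> \<alpha> a (tensor scale [x, y, z]) =
    tensor scale [\<mu> (\<alpha> a) x, \<alpha> y, \<alpha> z] - tensor scale [\<alpha> x, \<alpha> y, \<mu> z (\<alpha> a)]"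
proof -
  let ?F = "\<lambda>bs. tensor scale (\<mu> (\<alpha> a) (hd bs) # map \<alpha> (tl bs)) -
      tensor scale (map \<alpha> (butlast bs) @ [\<mu> (last bs) (\<alpha> a)])"
  \<comment> \<open>Multilinearity is required for words of every length. The varying letter is the
    head exactly when \<open>xs\<close> is empty; it then enters through
    \<open>\<mu> (\<alpha> a)\<close>, otherwise through \<open>\<alpha>\<close>.\<close>
  have left: "lin scale (\<lambda>x. tensor scale (\<mu> (\<alpha> a) (hd (xs @ x # ys)) # map \<alpha> (tl (xs @ x # ys))))"
    for xs ys
  proof (cases xs)
    case Nil
    then show ?thesis
      using linear_tensor[of "\<mu> (\<alpha> a)" "[]"] by (simp add: word_simps linear_mu_right)
  next
    case (Cons z zs)
    then show ?thesis
      using linear_tensor[of \<alpha> "\<mu> (\<alpha> a) z # map \<alpha> zs"] by (simp add: linear_alpha)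
  qed
  \<comment> \<open>Mirror image: the varying letter is the last one exactly when \<open>ys\<close>
    is empty.\<close>
  have right: "lin scale (\<lambda>x. tensor scale
      (map \<alpha> (butlast (xs @ x # ys)) @ [\<mu> (last (xs @ x # ys)) (\<alpha> a)]))" for xs ys
  proof (cases ys rule: rev_cases)
    case Nil
    then show ?thesis
      using linear_tensor[of "\<lambda>x. \<mu> x (\<alpha> a)" _ "[]"] by (simp add: word_simps)
  next
    case (snoc zs z)
    then show ?thesis
      using linear_tensor[of \<alpha> "map \<alpha> xs" "map \<alpha> zs @ [\<mu> z (\<alpha> a)]"]
      by (simp add: linear_alpha butlast_append)
  qed
  have "multilinear scale tscale ?F"
    unfolding multilinear_def by (intro allI linear_diff left right)
  then have "tensor_lift ?F (tensor scale [x, y, z]) = ?F [x, y, z]"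
    by (rule tensor_lift_tensor[where s' = scale]) (auto simp: in_tensors_simps)
  then show ?thesis
    by (simp add: bracket_bullet_def)
qed

lemma prod_13_12_sum:
  "prod_13_12 scale \<mu> \<alpha> (\<Sum>i\<in>I. tensor scale [x i, y i]) (\<Sum>j\<in>J. tensor scale [x' j, y' j]) =
    (\<Sum>i\<in>I. \<Sum>j\<in>J. tensor scale [\<mu> (x i) (x' j), \<alpha> (y' j), \<alpha> (y i)])"
  by (simp add: prod_13_12_def tensor_lift_distribs lift2_tensor word_simps)

lemma prod_12_23_sum:
  "prod_12_23 scale \<mu> \<alpha> (\<Sum>i\<in>I. tensor scale [x i, y i]) (\<Sum>j\<in>J. tensor scale [x' j, y' j]) =
    (\<Sum>i\<in>I. \<Sum>j\<in>J. tensor scale [\<alpha> (x i), \<mu> (y i) (x' j), \<alpha> (y' j)])"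
  by (simp add: prod_12_23_def tensor_lift_distribs lift2_tensor word_simps)

lemma prod_23_13_sum:
  "prod_23_13 scale \<mu> \<alpha> (\<Sum>i\<in>I. tensor scale [x i, y i]) (\<Sum>j\<in>J. tensor scale [x' j, y' j]) =
    (\<Sum>i\<in>I. \<Sum>j\<in>J. tensor scale [\<alpha> (x' j), \<alpha> (x i), \<mu> (y i) (y' j)])"
  by (simp add: prod_23_13_def tensor_lift_distribs lift2_tensor word_simps)

lemma Delta_in_tensors: "\<Delta> x \<in> tensors scale"
  using Delta_in by (rule tensor_power_tensors)

lemma Delta_minus_tensor:
  assumes "lin scale D" "\<And>x. D x \<in> tensors scale"
  shows "alpha_tensor_Delta_minus scale D \<alpha> (tensor scale [x, y]) =
    cons_tensor scale (\<alpha> x) (D y) - snoc_tensor scale (D x) (\<alpha> y)"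
  unfolding alpha_tensor_Delta_minus_def alpha_tensor_Delta_tensor[OF assms linear_alpha]
    Delta_tensor_alpha_tensor[OF assms linear_alpha] ..

lemma Delta_minus_distribs:
  "alpha_tensor_Delta_minus scale D \<alpha> (t + t') =
    alpha_tensor_Delta_minus scale D \<alpha> t + alpha_tensor_Delta_minus scale D \<alpha> t'"
  "alpha_tensor_Delta_minus scale D \<alpha> (t - t') =
    alpha_tensor_Delta_minus scale D \<alpha> t - alpha_tensor_Delta_minus scale D \<alpha> t'"
  "alpha_tensor_Delta_minus scale D \<alpha> (\<Sum>i\<in>I. f i) =
    (\<Sum>i\<in>I. alpha_tensor_Delta_minus scale D \<alpha> (f i))"
  unfolding alpha_tensor_Delta_minus_def tensor_map2_def tensor_lift_distribs
  by (simp_all only: sum_subtractf algebra_simps)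

lemma bracket_bullet_distribs:
  "bracket_bullet scale \<mu> \<alpha> a (t + t') =
    bracket_bullet scale \<mu> \<alpha> a t + bracket_bullet scale \<mu> \<alpha> a t'"
  "bracket_bullet scale \<mu> \<alpha> a (t - t') =
    bracket_bullet scale \<mu> \<alpha> a t - bracket_bullet scale \<mu> \<alpha> a t'"
  "bracket_bullet scale \<mu> \<alpha> a (\<Sum>i\<in>I. f i) = (\<Sum>i\<in>I. bracket_bullet scale \<mu> \<alpha> a (f i))"
  by (simp_all only: bracket_bullet_def tensor_lift_distribs)

lemma bracket_star_sum_right:
  "bracket_star scale \<mu> \<alpha> a (\<Sum>i\<in>I. f i) = (\<Sum>i\<in>I. bracket_star scale \<mu> \<alpha> a (f i))"
  by (simp only: bracket_star_def tensor_lift_distribs)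

lemma mu_tensor_alpha_distribs:
  "mu_tensor_alpha scale \<mu> \<alpha> (t + t') = mu_tensor_alpha scale \<mu> \<alpha> t + mu_tensor_alpha scale \<mu> \<alpha> t'"
  "mu_tensor_alpha scale \<mu> \<alpha> (t - t') = mu_tensor_alpha scale \<mu> \<alpha> t - mu_tensor_alpha scale \<mu> \<alpha> t'"
  "mu_tensor_alpha scale \<mu> \<alpha> (\<Sum>i\<in>I. f i) = (\<Sum>i\<in>I. mu_tensor_alpha scale \<mu> \<alpha> (f i))"
  "alpha_tensor_mu scale \<mu> \<alpha> (t + t') = alpha_tensor_mu scale \<mu> \<alpha> t + alpha_tensor_mu scale \<mu> \<alpha> t'"
  "alpha_tensor_mu scale \<mu> \<alpha> (t - t') = alpha_tensor_mu scale \<mu> \<alpha> t - alpha_tensor_mu scale \<mu> \<alpha> t'"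
  "alpha_tensor_mu scale \<mu> \<alpha> (\<Sum>i\<in>I. f i) = (\<Sum>i\<in>I. alpha_tensor_mu scale \<mu> \<alpha> (f i))"
  by (simp_all only: mu_tensor_alpha_def alpha_tensor_mu_def tensor_lift_distribs)

lemma alpha_tensor_alpha_distribs:
  "alpha_tensor_alpha scale \<alpha> (t + t') = alpha_tensor_alpha scale \<alpha> t + alpha_tensor_alpha scale \<alpha> t'"
  "alpha_tensor_alpha scale \<alpha> (t - t') = alpha_tensor_alpha scale \<alpha> t - alpha_tensor_alpha scale \<alpha> t'"
  "alpha_tensor_alpha scale \<alpha> (\<Sum>i\<in>I. f i) = (\<Sum>i\<in>I. alpha_tensor_alpha scale \<alpha> (f i))"
  by (simp_all only: alpha_tensor_alpha_def tensor_lift_distribs)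

text \<open>The lift of \<open>f\<close> takes equal values on an invariant tensor and on its image
  under \<alpha> \<otimes> \<alpha>. Hence \<open>\<alpha>\<close> may be inserted into, or removed
  from, both legs at once in any bilinear expression.\<close>

lemma alpha_invariant_sum:
  assumes "alpha_invariant scale \<alpha> (\<Sum>i\<in>I. tensor scale [u i, v i])"
    and "\<And>y. lin scale (\<lambda>x. f x y)" "\<And>x. lin scale (\<lambda>y. f x y)" "\<And>x y. f x y \<in> tensors scale"
  shows "(\<Sum>i\<in>I. f (u i) (v i)) = (\<Sum>i\<in>I. f (\<alpha> (u i)) (\<alpha> (v i)))"
proof -
  have "(\<Sum>i\<in>I. tensor scale [u i, v i]) = (\<Sum>i\<in>I. tensor scale [\<alpha> (u i), \<alpha> (v i)])"
    using assms(1) by (simp only: alpha_invariant_def alpha_tensor_alpha_distribs alpha_tensor_alpha_tensor)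
  then have "tensor_lift2 f (\<Sum>i\<in>I. tensor scale [u i, v i]) =
      tensor_lift2 f (\<Sum>i\<in>I. tensor scale [\<alpha> (u i), \<alpha> (v i)])"
    by (rule arg_cong)
  then show ?thesis
    by (simp only: tensor_lift_distribs lift2_tensor[OF assms(2-4)])
qed

section \<open>Contributions of an alpha-invariant 2-tensor to the coassociativity defect\<close>

context
  fixes n :: nat and u v :: "nat \<Rightarrow> 'a" and r :: "('k, 'a) tensor"
  assumes r: "r = (\<Sum>i<n. tensor scale [u i, v i])"
    and r_inv: "alpha_invariant scale \<alpha> r"
begin

lemmas invariant_sum = alpha_invariant_sum[of u v "{..<n}", folded r, OF r_inv]

lemma bracket_star_sum:
  "bracket_star scale \<mu> \<alpha> a r =
    (\<Sum>i<n. tensor scale [\<mu> a (u i), \<alpha> (v i)]) - (\<Sum>i<n. tensor scale [\<alpha> (u i), \<mu> (v i) a])"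
  by (simp only: r bracket_star_sum_right bracket_star_tensor sum_subtractf)

lemma lin_bracket_star: "lin scale (\<lambda>a. bracket_star scale \<mu> \<alpha> a r)"
  unfolding bracket_star_sum by (simp add: word_simps)

lemma bracket_star_in_tensors: "bracket_star scale \<mu> \<alpha> a r \<in> tensors scale"
  unfolding bracket_star_sum by (simp add: word_simps)

lemma bracket_star_in_power2: "bracket_star scale \<mu> \<alpha> a r \<in> tensor_power scale 2"
  using tensor_in_power2 unfolding bracket_star_sum tensor_power_def
  by (intro tensor_space.span_diff tensor_space.span_sum) blast+

text \<open>On x \<otimes> y the defect is \<alpha>(x) \<otimes> D(y) - D(x) \<otimes> \<alpha>(y),
  and each bracket contributes two sums. The tensor \<open>t\<close> will be
  \<open>\<Delta> a\<close> or one of the two halves of the bracket of \<open>a\<close> with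
  \<open>r\<close>.\<close>

lemma Delta_minus_bracket_star:
  assumes t: "t = (\<Sum>j\<in>J. tensor scale [x j, y j])"
  shows "alpha_tensor_Delta_minus scale (\<lambda>a. bracket_star scale \<mu> \<alpha> a r) \<alpha> t =
    prod_12_23 scale \<mu> \<alpha> t r - prod_23_13 scale \<mu> \<alpha> r t -
    (prod_13_12 scale \<mu> \<alpha> t r - prod_12_23 scale \<mu> \<alpha> r t)"
proof -
  have "alpha_tensor_Delta_minus scale (\<lambda>a. bracket_star scale \<mu> \<alpha> a r) \<alpha> t =
    (\<Sum>j\<in>J. \<Sum>i<n. tensor scale [\<alpha> (x j), \<mu> (y j) (u i), \<alpha> (v i)]) -
    (\<Sum>j\<in>J. \<Sum>i<n. tensor scale [\<alpha> (x j), \<alpha> (u i), \<mu> (v i) (y j)]) -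
    ((\<Sum>j\<in>J. \<Sum>i<n. tensor scale [\<mu> (x j) (u i), \<alpha> (v i), \<alpha> (y j)]) -
     (\<Sum>j\<in>J. \<Sum>i<n. tensor scale [\<alpha> (u i), \<mu> (v i) (x j), \<alpha> (y j)]))"
    by (simp only: t Delta_minus_distribs
        Delta_minus_tensor[OF lin_bracket_star bracket_star_in_tensors])
      (simp only: bracket_star_sum cons_tensor_distribs snoc_tensor_distribs cons_tensor_tensor snoc_tensor_tensor append.simps
        sum_subtractf)
  also have "\<dots> = prod_12_23 scale \<mu> \<alpha> t r - prod_23_13 scale \<mu> \<alpha> r t -
    (prod_13_12 scale \<mu> \<alpha> t r - prod_12_23 scale \<mu> \<alpha> r t)"
    \<comment> \<open>Products with \<open>r\<close> as first factor sum over \<open>r\<close>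
      outermost, the others over \<open>t\<close>, so the order of summation is made
      uniform.\<close>
    unfolding t r prod_12_23_sum prod_23_13_sum prod_13_12_sum
    by (simp only: sum.swap[of _ "{..<n}" J])
  finally show ?thesis .
qed

text \<open>With two copies of \<open>r\<close> present, invariance can be spent on one copy alone:
  summing over the other leaves a bilinear function of the legs of the first.\<close>

lemma invariant_sum_left:
  assumes "\<And>y x' y'. lin scale (\<lambda>x. f x y x' y')" "\<And>x x' y'. lin scale (\<lambda>y. f x y x' y')"
    and "\<And>x y x' y'. f x y x' y' \<in> tensors scale"
  shows "(\<Sum>i<n. \<Sum>j<n. f (u i) (v i) (u j) (v j)) =
    (\<Sum>i<n. \<Sum>j<n. f (\<alpha> (u i)) (\<alpha> (v i)) (u j) (v j))"
  by (rule invariant_sum[of "\<lambda>x y. \<Sum>j<n. f x y (u j) (v j)"])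
    (simp_all add: lin_sum tensor_space.span_sum assms)

lemma invariant_sum_right:
  assumes "\<And>x y y'. lin scale (\<lambda>x'. f x y x' y')" "\<And>x y x'. lin scale (\<lambda>y'. f x y x' y')"
    and "\<And>x y x' y'. f x y x' y' \<in> tensors scale"
  shows "(\<Sum>i<n. \<Sum>j<n. f (u i) (v i) (u j) (v j)) =
    (\<Sum>i<n. \<Sum>j<n. f (u i) (v i) (\<alpha> (u j)) (\<alpha> (v j)))"
  by (intro sum.cong refl invariant_sum[of "f x y" for x y] assms)

lemma Delta_minus_bracket_star_bracket_star:
  "alpha_tensor_Delta_minus scale (\<lambda>a. bracket_star scale \<mu> \<alpha> a r) \<alpha>
      (bracket_star scale \<mu> \<alpha> a r) = - bracket_bullet scale \<mu> \<alpha> a (A_tensor scale \<mu> \<alpha> r)"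
proof -
  let ?S = "\<lambda>f. \<Sum>i<n. \<Sum>j<n. tensor scale (f (u i) (v i) (u j) (v j))"
  txt \<open>The eight double sums of the left-hand side, with $\alpha$-invariance used to put every leg
    into the form it has in $[a,A(r)]_\bullet$; \<open>P2\<close> arises twice with opposite signs.\<close>
  define P1 P2 P3 P4 P5 P6 P7 where
    "P1 = ?S (\<lambda>x y x' y'. [\<mu> (\<alpha> a) (\<alpha> x), \<alpha> (\<mu> y x'), \<alpha> (\<alpha> y')])"
    and "P2 = ?S (\<lambda>x y x' y'. [\<alpha> (\<alpha> x), \<mu> (\<mu> y a) (\<alpha> x'), \<alpha> (\<alpha> y')])"
    and "P3 = ?S (\<lambda>x y x' y'. [\<alpha> (\<alpha> x), \<alpha> (\<mu> y x'), \<mu> (\<alpha> y') (\<alpha> a)])"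
    and "P4 = ?S (\<lambda>x y x' y'. [\<mu> (\<alpha> a) (\<alpha> x'), \<alpha> (\<alpha> x), \<alpha> (\<mu> y y')])"
    and "P5 = ?S (\<lambda>x y x' y'. [\<alpha> (\<alpha> x'), \<alpha> (\<alpha> x), \<mu> (\<mu> y y') (\<alpha> a)])"
    and "P6 = ?S (\<lambda>x y x' y'. [\<mu> (\<alpha> a) (\<mu> x x'), \<alpha> (\<alpha> y'), \<alpha> (\<alpha> y)])"
    and "P7 = ?S (\<lambda>x y x' y'. [\<alpha> (\<mu> x x'), \<alpha> (\<alpha> y'), \<mu> (\<alpha> y) (\<alpha> a)])"
  note P = this
  \<comment> \<open>In all of these, invariance goes to the copy of \<open>r\<close> outside the
    bracket with \<open>a\<close>. Multiplicativity of \<open>\<alpha>\<close> or Hom-associativity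
    then adjusts the legs where they still differ.\<close>
  have Q1: "?S (\<lambda>x y x' y'. [\<alpha> (\<mu> a x), \<mu> (\<alpha> y) x', \<alpha> y']) = P1"
    unfolding P by (subst invariant_sum_right) (simp_all add: word_simps alpha_mu)
  have Q2: "?S (\<lambda>x y x' y'. [\<alpha> (\<alpha> x), \<mu> (\<mu> y a) x', \<alpha> y']) = P2"
    unfolding P by (subst invariant_sum_right) (simp_all add: word_simps)
  \<comment> \<open>Hom-associativity identifies the two bracketings of \<open>a\<close> between the
    middle legs, which produces the cancelling pair.\<close>
  have Q2': "?S (\<lambda>x y x' y'. [\<alpha> x, \<mu> y (\<mu> a x'), \<alpha> (\<alpha> y')]) = P2"
    unfolding P by (subst invariant_sum_left) (simp_all add: word_simps hom_assoc)
  have Q3: "?S (\<lambda>x y x' y'. [\<alpha> x, \<mu> y (\<alpha> x'), \<alpha> (\<mu> y' a)]) = P3"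
    unfolding P by (subst invariant_sum_left) (simp_all add: word_simps alpha_mu)
  have Q4: "?S (\<lambda>x y x' y'. [\<alpha> (\<mu> a x'), \<alpha> x, \<mu> y (\<alpha> y')]) = P4"
    unfolding P by (subst invariant_sum_left) (simp_all add: word_simps alpha_mu)
  have Q5: "?S (\<lambda>x y x' y'. [\<alpha> (\<alpha> x'), \<alpha> x, \<mu> y (\<mu> y' a)]) = P5"
    unfolding P by (subst invariant_sum_left) (simp_all add: word_simps hom_assoc)
  have Q6: "?S (\<lambda>x y x' y'. [\<mu> (\<mu> a x) x', \<alpha> y', \<alpha> (\<alpha> y)]) = P6"
    unfolding P by (subst invariant_sum_right) (simp_all add: word_simps hom_assoc)
  have Q7: "?S (\<lambda>x y x' y'. [\<mu> (\<alpha> x) x', \<alpha> y', \<alpha> (\<mu> y a)]) = P7"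
    unfolding P by (subst invariant_sum_right) (simp_all add: word_simps alpha_mu)
  let ?X = "\<Sum>i<n. tensor scale [\<mu> a (u i), \<alpha> (v i)]"
  let ?Y = "\<Sum>i<n. tensor scale [\<alpha> (u i), \<mu> (v i) a]"
  have "prod_12_23 scale \<mu> \<alpha> ?X r = P1" "prod_12_23 scale \<mu> \<alpha> ?Y r = P2"
    "prod_12_23 scale \<mu> \<alpha> r ?X = P2" "prod_12_23 scale \<mu> \<alpha> r ?Y = P3"
    "prod_23_13 scale \<mu> \<alpha> r ?X = P4" "prod_23_13 scale \<mu> \<alpha> r ?Y = P5"
    "prod_13_12 scale \<mu> \<alpha> ?X r = P6" "prod_13_12 scale \<mu> \<alpha> ?Y r = P7"
    unfolding r prod_12_23_sum prod_23_13_sum prod_13_12_sum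
    by (simp_all only: Q1 Q2 Q2' Q3 Q4 Q5 Q6 Q7)
  then have "alpha_tensor_Delta_minus scale (\<lambda>a. bracket_star scale \<mu> \<alpha> a r) \<alpha>
      (bracket_star scale \<mu> \<alpha> a r) = P1 - P4 - (P6 - P2) - (P2 - P5 - (P7 - P3))"
    \<comment> \<open>The instance at \<open>a\<close> expands only the argument; the abstracted
      bracket stays intact, so that \<open>Delta_minus_bracket_star\<close> still matches.\<close>
    unfolding bracket_star_sum[of a] Delta_minus_distribs(2)
      Delta_minus_bracket_star[OF refl] by simp
  moreover have "bracket_bullet scale \<mu> \<alpha> a (A_tensor scale \<mu> \<alpha> r) = P6 - P7 - (P1 - P3) + (P4 - P5)"
    unfolding A_tensor_def r prod_12_23_sum prod_23_13_sum prod_13_12_sum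
      bracket_bullet_distribs bracket_bullet_tensor sum_subtractf P ..
  ultimately show ?thesis
    by (simp only:) (simp add: algebra_simps)
qed

lemma Delta_minus_Delta_bracket_star:
  "alpha_tensor_Delta_minus scale \<Delta> \<alpha> (bracket_star scale \<mu> \<alpha> a r) =
    bracket_bullet scale \<mu> \<alpha> a (alpha_tensor_Delta_minus scale \<Delta> \<alpha> r) -
    (prod_12_23 scale \<mu> \<alpha> (\<Delta> a) r + prod_12_23 scale \<mu> \<alpha> r (\<Delta> a))"
proof -
  \<comment> \<open>Legs are chosen for all elements simultaneously, because \<open>\<Delta>\<close>
    is expanded at \<open>a\<close> and at both legs of \<open>r\<close>.\<close>
  have "\<forall>x. \<exists>(m::nat) p q. \<Delta> x = (\<Sum>j<m. tensor scale [p j, q j])"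
    using Delta_in tensor_power2_cases by metis
  then obtain m :: "'a \<Rightarrow> nat" and p q where D: "\<And>x. \<Delta> x = (\<Sum>j<m x. tensor scale [p x j, q x j])"
    by metis
  \<comment> \<open>Compatibility with \<open>\<alpha>\<close> expresses this through the legs of
    \<open>\<Delta> x\<close>, not those chosen for \<open>\<alpha> x\<close>.\<close>
  have D_alpha: "\<Delta> (\<alpha> x) = (\<Sum>j<m x. tensor scale [\<alpha> (p x j), \<alpha> (q x j)])" for x
    unfolding alpha_Delta[symmetric] D[of x] alpha_tensor_alpha_distribs alpha_tensor_alpha_tensor ..
  have D_mu: "\<Delta> (\<mu> x y) = (\<Sum>j<m y. tensor scale [\<mu> (\<alpha> x) (p y j), \<alpha> (q y j)]) +
      (\<Sum>j<m x. tensor scale [\<alpha> (p x j), \<mu> (q x j) (\<alpha> y)])" for x y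
    unfolding Delta_mu alpha_tensor_Delta_tensor[OF linear_Delta Delta_in_tensors linear_alpha]
      Delta_tensor_alpha_tensor[OF linear_Delta Delta_in_tensors linear_alpha]
      D[of x] D[of y] cons_tensor_distribs snoc_tensor_distribs cons_tensor_tensor snoc_tensor_tensor
      append.simps mu_tensor_alpha_distribs mu_tensor_alpha_tensor alpha_tensor_mu_tensor ..
  note J = Delta_minus_tensor[OF linear_Delta Delta_in_tensors]
  \<comment> \<open>In \<open>T2'\<close> and \<open>T3\<close> the comultiplication splits
    \<open>a\<close>; in the other four it splits a leg of \<open>r\<close>, and these make up the
    bullet bracket.\<close>
  define T1 T2 T2' T3 T3' T4 where
    "T1 = (\<Sum>i<n. \<Sum>j<m (v i).
      tensor scale [\<mu> (\<alpha> a) (\<alpha> (u i)), \<alpha> (p (v i) j), \<alpha> (q (v i) j)])"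
    and "T2 = (\<Sum>i<n. \<Sum>j<m (u i).
      tensor scale [\<mu> (\<alpha> a) (p (u i) j), \<alpha> (q (u i) j), \<alpha> (\<alpha> (v i))])"
    and "T2' = (\<Sum>i<n. \<Sum>j<m a. tensor scale [\<alpha> (p a j), \<mu> (q a j) (\<alpha> (u i)), \<alpha> (\<alpha> (v i))])"
    and "T3 = (\<Sum>i<n. \<Sum>j<m a. tensor scale [\<alpha> (\<alpha> (u i)), \<mu> (\<alpha> (v i)) (p a j), \<alpha> (q a j)])"
    and "T3' = (\<Sum>i<n. \<Sum>j<m (v i).
      tensor scale [\<alpha> (\<alpha> (u i)), \<alpha> (p (v i) j), \<mu> (q (v i) j) (\<alpha> a)])"
    and "T4 = (\<Sum>i<n. \<Sum>j<m (u i).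
      tensor scale [\<alpha> (p (u i) j), \<alpha> (q (u i) j), \<mu> (\<alpha> (v i)) (\<alpha> a)])"
  note T = this
  have "alpha_tensor_Delta_minus scale \<Delta> \<alpha> (bracket_star scale \<mu> \<alpha> a r) =
      T1 - (T2 + T2') - (T3 + T3' - T4)"
    unfolding bracket_star_sum Delta_minus_distribs J D_alpha D_mu alpha_mu
      cons_tensor_distribs snoc_tensor_distribs cons_tensor_tensor snoc_tensor_tensor append.simps
      sum_subtractf sum.distrib T ..
  moreover have "bracket_bullet scale \<mu> \<alpha> a (alpha_tensor_Delta_minus scale \<Delta> \<alpha> r) =
      T1 - T3' - (T2 - T4)"
    unfolding r Delta_minus_distribs J D
      cons_tensor_distribs snoc_tensor_distribs cons_tensor_tensor snoc_tensor_tensor append.simps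
      bracket_bullet_distribs bracket_bullet_tensor sum_subtractf T ..
  moreover have "prod_12_23 scale \<mu> \<alpha> (\<Delta> a) r = T2'"
  proof -
    have "prod_12_23 scale \<mu> \<alpha> (\<Delta> a) r =
        (\<Sum>i<n. \<Sum>j<m a. tensor scale [\<alpha> (p a j), \<mu> (q a j) (u i), \<alpha> (v i)])"
      unfolding r D prod_12_23_sum by (rule sum.swap)
    also have "\<dots> = T2'"
      \<comment> \<open>\<open>T2'\<close> carries one more \<open>\<alpha>\<close> on each leg of
        \<open>r\<close>, which invariance accounts for; likewise \<open>T3\<close> below.\<close>
      unfolding T
      by (rule invariant_sum[of "\<lambda>x y. \<Sum>j<m a. tensor scale [\<alpha> (p a j), \<mu> (q a j) x, \<alpha> y]"])
        (simp_all add: word_simps)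
    finally show ?thesis .
  qed
  moreover have "prod_12_23 scale \<mu> \<alpha> r (\<Delta> a) = T3"
  proof -
    have "prod_12_23 scale \<mu> \<alpha> r (\<Delta> a) =
        (\<Sum>i<n. \<Sum>j<m a. tensor scale [\<alpha> (u i), \<mu> (v i) (p a j), \<alpha> (q a j)])"
      unfolding r D prod_12_23_sum ..
    also have "\<dots> = T3"
      unfolding T
      by (rule invariant_sum[of "\<lambda>x y. \<Sum>j<m a. tensor scale [\<alpha> x, \<mu> y (p a j), \<alpha> (q a j)]"])
        (simp_all add: word_simps)
    finally show ?thesis .
  qed
  ultimately show ?thesis
    by (simp only:) (simp add: algebra_simps)
qed

section \<open>The axioms for the perturbed comultiplication\<close>

lemma linear_Delta_perturbed: "lin scale (Delta_perturbed scale \<mu> \<Delta> \<alpha> r)"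
  unfolding Delta_perturbed_def by (rule linear_add[OF linear_Delta lin_bracket_star])

lemma Delta_perturbed_in: "Delta_perturbed scale \<mu> \<Delta> \<alpha> r a \<in> tensor_power scale 2"
  using Delta_in bracket_star_in_power2 unfolding Delta_perturbed_def tensor_power_def
  by (rule tensor_space.span_add)

text \<open>The defect is additive in the comultiplication; this is read off on pure tensors, so
  \<open>t\<close> is taken from the second tensor power.\<close>

lemma Delta_minus_Delta_perturbed:
  assumes "t \<in> tensor_power scale 2"
  shows "alpha_tensor_Delta_minus scale (Delta_perturbed scale \<mu> \<Delta> \<alpha> r) \<alpha> t =
    alpha_tensor_Delta_minus scale \<Delta> \<alpha> t +
    alpha_tensor_Delta_minus scale (\<lambda>a. bracket_star scale \<mu> \<alpha> a r) \<alpha> t"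
proof -
  obtain k :: nat and x y where t: "t = (\<Sum>i<k. tensor scale [x i, y i])"
    using assms by (rule tensor_power2_cases)
  show ?thesis
    unfolding t Delta_minus_distribs
      Delta_minus_tensor[OF linear_Delta_perturbed tensor_power_tensors[OF Delta_perturbed_in]]
      Delta_minus_tensor[OF linear_Delta Delta_in_tensors]
      Delta_minus_tensor[OF lin_bracket_star bracket_star_in_tensors]
      Delta_perturbed_def cons_tensor_distribs snoc_tensor_distribs sum.distrib[symmetric]
    by (intro sum.cong refl) (simp only: algebra_simps)
qed

text \<open>The two \<open>prod_12_23\<close> terms pairing \<open>r\<close> with
  \<open>\<Delta> a\<close> enter with opposite signs from
  \<open>Delta_minus_Delta_bracket_star\<close> and \<open>Delta_minus_bracket_star\<close>. What
  survives is the difference of the two sides of the claimed condition.\<close>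

lemma Delta_minus_Delta_perturbed_Delta_perturbed:
  "alpha_tensor_Delta_minus scale (Delta_perturbed scale \<mu> \<Delta> \<alpha> r) \<alpha>
      (Delta_perturbed scale \<mu> \<Delta> \<alpha> r a) =
    bracket_bullet scale \<mu> \<alpha> a
      (alpha_tensor_Delta_minus scale \<Delta> \<alpha> r - A_tensor scale \<mu> \<alpha> r) -
    (prod_23_13 scale \<mu> \<alpha> r (\<Delta> a) + prod_13_12 scale \<mu> \<alpha> (\<Delta> a) r)"
proof -
  obtain k :: nat and x y where D: "\<Delta> a = (\<Sum>i<k. tensor scale [x i, y i])"
    using Delta_in by (rule tensor_power2_cases)
  have "alpha_tensor_Delta_minus scale \<Delta> \<alpha> (\<Delta> a) = 0"
    using hom_coassoc unfolding alpha_tensor_Delta_minus_def by (simp only: diff_self)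
  moreover have "alpha_tensor_Delta_minus scale (Delta_perturbed scale \<mu> \<Delta> \<alpha> r) \<alpha>
      (Delta_perturbed scale \<mu> \<Delta> \<alpha> r a) =
    alpha_tensor_Delta_minus scale \<Delta> \<alpha> (\<Delta> a) +
    alpha_tensor_Delta_minus scale \<Delta> \<alpha> (bracket_star scale \<mu> \<alpha> a r) +
    (alpha_tensor_Delta_minus scale (\<lambda>a. bracket_star scale \<mu> \<alpha> a r) \<alpha> (\<Delta> a) +
     alpha_tensor_Delta_minus scale (\<lambda>a. bracket_star scale \<mu> \<alpha> a r) \<alpha>
       (bracket_star scale \<mu> \<alpha> a r))"
    unfolding Delta_minus_Delta_perturbed[OF Delta_perturbed_in]
    by (simp only: Delta_perturbed_def Delta_minus_distribs)
  ultimately show ?thesis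
    unfolding Delta_minus_Delta_bracket_star Delta_minus_bracket_star[OF D]
      Delta_minus_bracket_star_bracket_star bracket_bullet_distribs
    by (simp only:) (simp add: algebra_simps)
qed

text \<open>Multiplicativity moves \<open>\<alpha>\<close> onto \<open>a\<close> and the legs of
  \<open>r\<close>, and invariance removes it from the legs again.\<close>

lemma alpha_Delta_perturbed:
  "alpha_tensor_alpha scale \<alpha> (Delta_perturbed scale \<mu> \<Delta> \<alpha> r a) =
    Delta_perturbed scale \<mu> \<Delta> \<alpha> r (\<alpha> a)"
proof -
  have "(\<Sum>i<n. tensor scale [\<mu> (\<alpha> a) (\<alpha> (u i)), \<alpha> (\<alpha> (v i))]) =
      (\<Sum>i<n. tensor scale [\<mu> (\<alpha> a) (u i), \<alpha> (v i)])"
    by (subst invariant_sum[of "\<lambda>x y. tensor scale [\<mu> (\<alpha> a) x, \<alpha> y]"]) (simp_all add: word_simps)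
  moreover have "(\<Sum>i<n. tensor scale [\<alpha> (\<alpha> (u i)), \<mu> (\<alpha> (v i)) (\<alpha> a)]) =
      (\<Sum>i<n. tensor scale [\<alpha> (u i), \<mu> (v i) (\<alpha> a)])"
    by (subst invariant_sum[of "\<lambda>x y. tensor scale [\<alpha> x, \<mu> y (\<alpha> a)]"]) (simp_all add: word_simps)
  ultimately show ?thesis
    unfolding Delta_perturbed_def bracket_star_sum alpha_tensor_alpha_distribs
      alpha_tensor_alpha_tensor alpha_Delta alpha_mu by (simp only:)
qed

text \<open>The bracket with \<open>r\<close> satisfies the same derivation rule as
  \<open>\<Delta>\<close>: invariance supplies the \<open>\<alpha>\<close> needed for
  Hom-associativity, and the mixed terms with \<open>x\<close> on the left leg and \<open>y\<close>
  on the right leg cancel.\<close>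

lemma Delta_perturbed_mu:
  "Delta_perturbed scale \<mu> \<Delta> \<alpha> r (\<mu> x y) =
    mu_tensor_alpha scale \<mu> \<alpha>
      (alpha_tensor_Delta scale (Delta_perturbed scale \<mu> \<Delta> \<alpha> r) \<alpha> (tensor scale [x, y])) +
    alpha_tensor_mu scale \<mu> \<alpha>
      (Delta_tensor_alpha scale (Delta_perturbed scale \<mu> \<Delta> \<alpha> r) \<alpha> (tensor scale [x, y]))"
proof -
  have inv1: "(\<Sum>i<n. tensor scale [\<mu> (\<mu> x y) (u i), \<alpha> (v i)]) =
      (\<Sum>i<n. tensor scale [\<mu> (\<mu> x y) (\<alpha> (u i)), \<alpha> (\<alpha> (v i))])"
    by (rule invariant_sum[of "\<lambda>a b. tensor scale [\<mu> (\<mu> x y) a, \<alpha> b]"]) (simp_all add: word_simps)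
  have inv2: "(\<Sum>i<n. tensor scale [\<alpha> (u i), \<mu> (v i) (\<mu> x y)]) =
      (\<Sum>i<n. tensor scale [\<alpha> (\<alpha> (u i)), \<mu> (\<alpha> (v i)) (\<mu> x y)])"
    by (rule invariant_sum[of "\<lambda>a b. tensor scale [\<alpha> a, \<mu> b (\<mu> x y)]"]) (simp_all add: word_simps)
  note D = alpha_tensor_Delta_tensor Delta_tensor_alpha_tensor
  note D' = D[OF linear_Delta_perturbed tensor_power_tensors[OF Delta_perturbed_in] linear_alpha]
  show ?thesis
    unfolding D' D[OF linear_Delta Delta_in_tensors linear_alpha] Delta_perturbed_def Delta_mu
      bracket_star_sum cons_tensor_distribs snoc_tensor_distribs cons_tensor_tensor
      snoc_tensor_tensor append.simps mu_tensor_alpha_distribs mu_tensor_alpha_tensor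
      alpha_tensor_mu_tensor inv1 inv2 hom_assoc alpha_mu
    by (simp only: algebra_simps)
qed

lemma eps_hom_bialgebra_Delta_perturbed:
  "eps_hom_bialgebra scale \<mu> (Delta_perturbed scale \<mu> \<Delta> \<alpha> r) \<alpha> \<longleftrightarrow>
    (\<forall>a. bracket_bullet scale \<mu> \<alpha> a
            (alpha_tensor_Delta_minus scale \<Delta> \<alpha> r - A_tensor scale \<mu> \<alpha> r) =
          prod_23_13 scale \<mu> \<alpha> r (\<Delta> a) + prod_13_12 scale \<mu> \<alpha> (\<Delta> a) r)"
    (is "eps_hom_bialgebra _ _ ?D _ \<longleftrightarrow> ?R")
proof -
  have "?R \<longleftrightarrow> (\<forall>a. alpha_tensor_Delta_minus scale ?D \<alpha> (?D a) = 0)"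
    unfolding Delta_minus_Delta_perturbed_Delta_perturbed right_minus_eq ..
  also have "\<dots> \<longleftrightarrow> (\<forall>a. alpha_tensor_Delta scale ?D \<alpha> (?D a) = Delta_tensor_alpha scale ?D \<alpha> (?D a))"
    unfolding alpha_tensor_Delta_minus_def right_minus_eq ..
  also have "\<dots> \<longleftrightarrow> eps_hom_bialgebra scale \<mu> ?D \<alpha>"
    \<comment> \<open>These facts cover every locale axiom except Hom-coassociativity, which is the
      left-hand side of the equivalence.\<close>
    using linear_mu_left linear_mu_right linear_Delta_perturbed Delta_perturbed_in linear_alpha
      alpha_mu hom_assoc alpha_Delta_perturbed Delta_perturbed_mu vector_space_axioms
    unfolding eps_hom_bialgebra_def eps_hom_bialgebra_axioms_def by blast
  finally show ?thesis ..
qed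

end

end

theorem theorem4p1:
  fixes scale :: "'k::field_char_0 \<Rightarrow> 'a::ab_group_add \<Rightarrow> 'a"
    and \<mu> :: "'a \<Rightarrow> 'a \<Rightarrow> 'a"
    and \<Delta> :: "'a \<Rightarrow> ('k, 'a) tensor"
    and \<alpha> :: "'a \<Rightarrow> 'a"
    and r :: "('k, 'a) tensor"
  assumes "eps_hom_bialgebra scale \<mu> \<Delta> \<alpha>"
    and "r \<in> tensor_power scale 2"
    and "alpha_invariant scale \<alpha> r"
  shows "eps_hom_bialgebra scale \<mu> (Delta_perturbed scale \<mu> \<Delta> \<alpha> r) \<alpha> \<longleftrightarrow>
    (\<forall>a. bracket_bullet scale \<mu> \<alpha> a
            (alpha_tensor_Delta_minus scale \<Delta> \<alpha> r - A_tensor scale \<mu> \<alpha> r) =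
          prod_23_13 scale \<mu> \<alpha> r (\<Delta> a) + prod_13_12 scale \<mu> \<alpha> (\<Delta> a) r)"
proof -
  interpret eps_hom_bialgebra scale \<mu> \<Delta> \<alpha> by fact
  \<comment> \<open>The preceding equivalence was derived from a chosen representation of
    \<open>r\<close>, but its statement depends on \<open>r\<close> alone.\<close>
  obtain n :: nat and u v where "r = (\<Sum>i<n. tensor scale [u i, v i])"
    using assms(2) by (rule tensor_power2_cases)
  then show ?thesis
    using assms(3) by (rule eps_hom_bialgebra_Delta_perturbed)
qed

end
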